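(* Let $N=N_{\mathrm{grid}}$ and $M=N_{\mathrm{data}}$ be positive integers, $a_1,\dots,a_M$ data points, $w_1,\dots,w_M>0$ weights, $\lambda>0$, $G$ the (symmetric positive definite, $d\times d$) matrix function of a Riemannian metric in local coordinates, and $S$ a real-valued function bounded from below. Given the iterate $(z^{(k)}_{s,i}),(u^{(k)}_{s,i})$ in iteration $k$, fix $$G_{s,i}:=G\big(z_{s,i}^{(k)}\big)\quad(s=0,\dots,N-1,\ i=1,\dots,M),$$ $$\nu_{s,i}:=\nabla_z\Big(w_iu_{s,i}^{\top}G(z)u_{s,i}+\lambda S(z)\Big)\Big|_{z=z^{(k)}_{s,i},\,u_{s,i}=u_{s,i}^{(k)}}\quad(s=1,\dots,N-1,\ i=1,\dots,M).$$ With these quantities fixed, the necessary conditions for a minimum of the discretized generalized Fréchet mean problem reduce to the system $$2w_iG_{s,i}u_{s,i}+\mu_{s,i}=0,\quad z_{s+1,i}=z_{s,i}+u_{s,i}\quad(s=0,\dots,N-1,\ i=1,\dots,M),$$ $$\nu_{s,i}+\mu_{s,i}=\mu_{s-1,i}\ (s=1,\dots,N-1,\ i=1,\dots,M),\qquad \sum_{i=1}^M\mu_{N-1,i}=0,\qquad z_{0,i}=a_i,\ z_{N,i}=y\ (i=1,\dots,M),$$ and the update scheme of $u_{s,i}$, $\mu_{s,i}$ and $z_{s,i}$ (the closed-form solution of this system) is $$y=W^{-1}V,$$ $$\mu_{N-1,i}=\Big(\sum_{s=0}^{N-1}G_{s,i}^{-1}\Big)^{-1}\Big(2w_i(a_i-y)-\sum_{s=0}^{N-1}G_{s,i}^{-1}\sum_{j>s}^{N-1}\nu_{j,i}\Big),\quad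 i=1,\dots,M,$$ $$u_{s,i}=-\frac{1}{2w_i}G_{s,i}^{-1}\Big(\mu_{N-1,i}+\sum_{j>s}^{N-1}\nu_{j,i}\Big),\quad s=0,\dots,N-1,\ i=1,\dots,M,$$ $$z_{s+1,i}=z_{s,i}+u_{s,i},\quad s=0,\dots,N-2,\ i=1,\dots,M,$$ $$z_{0,i}=a_i,\quad i=1,\dots,M,$$ where $$W=\sum_{i=1}^{M}w_i\Big(\sum_{s=0}^{N-1}G_{s,i}^{-1}\Big)^{-1},$$ $$V=\sum_{i=1}^{M}w_i\Big(\sum_{s=0}^{N-1}G_{s,i}^{-1}\Big)^{-1}a_i-\frac12\sum_{i=1}^{M}\Big(\sum_{s=0}^{N-1}G_{s,i}^{-1}\Big)^{-1}\sum_{s=0}^{N-1}G_{s,i}^{-1}\sum_{j>s}^{N-1}\nu_{j,i}.$$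
   Context: The discretized generalized Fréchet mean problem is: minimize $\sum_{i=1}^{M}w_i\sum_{s=0}^{N-1}\big(u_{s,i}^{\top}G(z_{s,i})u_{s,i}+\lambda S(z_{s,i})\big)$ over $(z_{s,i},u_{s,i})$ subject to $z_{s+1,i}=z_{s,i}+u_{s,i}$, $z_{0,i}=a_i$, $z_{N,i}=y$ with $y$ free, in local coordinates in $\mathbb{R}^d$. The vectors $\mu_{s,i}\in\mathbb{R}^d$ are the dual variables of this problem. The sum $\sum_{j>s}^{N-1}$ runs over $j=s+1,\dots,N-1$, and empty sums are zero.
   Formalization: The objective weights S by w_iλ but the printed ν_{s,i} uses λS, so the reduction fails unless w_i=1 or ∇S=0; the formal version uses one common factor of S in both objective and ν, either w_iλ or λ. *)

theory Defs
  imports "HOL-Analysis.Analysis"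
begin

text \<open>
  Indexed families are functions \<open>z s i\<close> with time index \<open>s \<in> {0..N}\<close> (or \<open>s < N\<close>) and data index
  \<open>i \<in> {1..M}\<close>; values outside these ranges are never constrained.  The set \<open>U\<close> is the open
  coordinate domain in \<open>\<real>\<^sup>d\<close>.
\<close>

subsection \<open>The discretized problem\<close>

definition stage_cost ::
  "(real^'d \<Rightarrow> real^'d^'d) \<Rightarrow> (real^'d \<Rightarrow> real) \<Rightarrow> real \<Rightarrow> real \<Rightarrow> real^'d \<Rightarrow> real^'d \<Rightarrow> real" where
  "stage_cost G S \<omega> \<rho> x v = \<omega> * (v \<bullet> (G x *v v)) + \<rho> * S x"

text \<open>
  \<open>\<rho> i\<close> is the factor in front of \<open>S\<close> in the \<open>i\<close>-th summand.  The objective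
  \<open>\<Sum>\<^sub>i w\<^sub>i \<Sum>\<^sub>s (u\<^sup>T G(z) u + \<lambda> S(z))\<close> is the case \<open>\<rho> i = w i * \<lambda>\<close>, see \<open>frechet_cost_weighted\<close>.
\<close>

definition frechet_cost ::
  "nat \<Rightarrow> nat \<Rightarrow> (real^'d \<Rightarrow> real^'d^'d) \<Rightarrow> (real^'d \<Rightarrow> real) \<Rightarrow> (nat \<Rightarrow> real) \<Rightarrow> (nat \<Rightarrow> real) \<Rightarrow>
   (nat \<Rightarrow> nat \<Rightarrow> real^'d) \<Rightarrow> (nat \<Rightarrow> nat \<Rightarrow> real^'d) \<Rightarrow> real" where
  "frechet_cost N M G S w \<rho> z u =
     (\<Sum>i=1..M. \<Sum>s<N. stage_cost G S (w i) (\<rho> i) (z s i) (u s i))"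

lemma frechet_cost_weighted:
  "frechet_cost N M G S w (\<lambda>i. w i * lam) z u =
     (\<Sum>i=1..M. w i * (\<Sum>s<N. u s i \<bullet> (G (z s i) *v u s i) + lam * S (z s i)))"
  by (simp add: frechet_cost_def stage_cost_def sum_distrib_left distrib_left mult.assoc)

definition feasible ::
  "nat \<Rightarrow> nat \<Rightarrow> (real^'d) set \<Rightarrow> (nat \<Rightarrow> real^'d) \<Rightarrow>
   real^'d \<Rightarrow> (nat \<Rightarrow> nat \<Rightarrow> real^'d) \<Rightarrow> (nat \<Rightarrow> nat \<Rightarrow> real^'d) \<Rightarrow> bool" where
  "feasible N M U a y z u \<longleftrightarrow>
     (\<forall>i\<in>{1..M}. (\<forall>s\<le>N. z s i \<in> U) \<and> z 0 i = a i \<and> z N i = y \<and>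
        (\<forall>s<N. z (Suc s) i = z s i + u s i))"

definition local_minimizer ::
  "nat \<Rightarrow> nat \<Rightarrow> (real^'d) set \<Rightarrow> (nat \<Rightarrow> real^'d) \<Rightarrow>
   (real^'d \<Rightarrow> real^'d^'d) \<Rightarrow> (real^'d \<Rightarrow> real) \<Rightarrow> (nat \<Rightarrow> real) \<Rightarrow> (nat \<Rightarrow> real) \<Rightarrow>
   real^'d \<Rightarrow> (nat \<Rightarrow> nat \<Rightarrow> real^'d) \<Rightarrow> (nat \<Rightarrow> nat \<Rightarrow> real^'d) \<Rightarrow> bool" where
  "local_minimizer N M U a G S w \<rho> y z u \<longleftrightarrow>
     feasible N M U a y z u \<and>
     (\<exists>\<epsilon>>0. \<forall>y' z' u'. feasible N M U a y' z' u' \<longrightarrow>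
        (\<forall>i\<in>{1..M}. (\<forall>s\<le>N. dist (z' s i) (z s i) < \<epsilon>) \<and> (\<forall>s<N. dist (u' s i) (u s i) < \<epsilon>)) \<longrightarrow>
        frechet_cost N M G S w \<rho> z u \<le> frechet_cost N M G S w \<rho> z' u')"

subsection \<open>First-order necessary conditions\<close>

definition lagrangian ::
  "nat \<Rightarrow> nat \<Rightarrow> (real^'d \<Rightarrow> real^'d^'d) \<Rightarrow> (real^'d \<Rightarrow> real) \<Rightarrow> (nat \<Rightarrow> real) \<Rightarrow> (nat \<Rightarrow> real) \<Rightarrow>
   (nat \<Rightarrow> nat \<Rightarrow> real^'d) \<Rightarrow> (nat \<Rightarrow> nat \<Rightarrow> real^'d) \<Rightarrow> (nat \<Rightarrow> nat \<Rightarrow> real^'d) \<Rightarrow> real" where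
  "lagrangian N M G S w \<rho> z u \<mu> =
     frechet_cost N M G S w \<rho> z u +
     (\<Sum>i=1..M. \<Sum>s<N. \<mu> s i \<bullet> (z s i + u s i - z (Suc s) i))"

definition upd :: "(nat \<Rightarrow> nat \<Rightarrow> 'b) \<Rightarrow> nat \<Rightarrow> nat \<Rightarrow> 'b \<Rightarrow> nat \<Rightarrow> nat \<Rightarrow> 'b" where
  "upd z s i v = z(s := (z s)(i := v))"

text \<open>
  The multipliers \<open>\<mu>\<close> belong to the dynamics; the endpoint constraints are eliminated, so the free
  variables are \<open>u s i\<close> for \<open>s < N\<close>, \<open>z s i\<close> for \<open>1 \<le> s < N\<close>, and the common endpoint \<open>y\<close>, which
  occurs as \<open>z N i\<close> for all \<open>i\<close> simultaneously.
\<close>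

definition necessary_conditions ::
  "nat \<Rightarrow> nat \<Rightarrow> (real^'d) set \<Rightarrow> (nat \<Rightarrow> real^'d) \<Rightarrow>
   (real^'d \<Rightarrow> real^'d^'d) \<Rightarrow> (real^'d \<Rightarrow> real) \<Rightarrow> (nat \<Rightarrow> real) \<Rightarrow> (nat \<Rightarrow> real) \<Rightarrow> real^'d \<Rightarrow>
   (nat \<Rightarrow> nat \<Rightarrow> real^'d) \<Rightarrow> (nat \<Rightarrow> nat \<Rightarrow> real^'d) \<Rightarrow> (nat \<Rightarrow> nat \<Rightarrow> real^'d) \<Rightarrow> bool" where
  "necessary_conditions N M U a G S w \<rho> y z u \<mu> \<longleftrightarrow>
     feasible N M U a y z u \<and>
     (\<forall>i\<in>{1..M}. \<forall>s\<in>{0..<N}.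
        GDERIV (\<lambda>v. lagrangian N M G S w \<rho> z (upd u s i v) \<mu>) (u s i) :> 0) \<and>
     (\<forall>i\<in>{1..M}. \<forall>s\<in>{1..<N}.
        GDERIV (\<lambda>x. lagrangian N M G S w \<rho> (upd z s i x) u \<mu>) (z s i) :> 0) \<and>
     GDERIV (\<lambda>x. lagrangian N M G S w \<rho> (z(N := (\<lambda>i. x))) u \<mu>) y :> 0"

subsection \<open>The system with frozen coefficients and its closed-form solution\<close>

text \<open>\<open>H s i\<close> and \<open>\<nu> s i\<close> are the fixed matrices \<open>G\<^sub>s\<^sub>,\<^sub>i\<close> and the fixed gradients.\<close>

definition frozen_system ::
  "nat \<Rightarrow> nat \<Rightarrow> (nat \<Rightarrow> real^'d) \<Rightarrow> (nat \<Rightarrow> real) \<Rightarrow>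
   (nat \<Rightarrow> nat \<Rightarrow> real^'d^'d) \<Rightarrow> (nat \<Rightarrow> nat \<Rightarrow> real^'d) \<Rightarrow> real^'d \<Rightarrow>
   (nat \<Rightarrow> nat \<Rightarrow> real^'d) \<Rightarrow> (nat \<Rightarrow> nat \<Rightarrow> real^'d) \<Rightarrow> (nat \<Rightarrow> nat \<Rightarrow> real^'d) \<Rightarrow> bool" where
  "frozen_system N M a w H \<nu> y z u \<mu> \<longleftrightarrow>
     (\<forall>i\<in>{1..M}. \<forall>s\<in>{0..<N}. (2 * w i) *\<^sub>R (H s i *v u s i) + \<mu> s i = 0) \<and>
     (\<forall>i\<in>{1..M}. \<forall>s\<in>{0..<N}. z (s + 1) i = z s i + u s i) \<and>
     (\<forall>i\<in>{1..M}. \<forall>s\<in>{1..<N}. \<nu> s i + \<mu> s i = \<mu> (s - 1) i) \<and>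
     (\<Sum>i=1..M. \<mu> (N - 1) i) = 0 \<and>
     (\<forall>i\<in>{1..M}. z 0 i = a i \<and> z N i = y)"

definition nu_tail :: "nat \<Rightarrow> (nat \<Rightarrow> nat \<Rightarrow> real^'d) \<Rightarrow> nat \<Rightarrow> nat \<Rightarrow> real^'d" where
  "nu_tail N \<nu> s i = (\<Sum>j\<in>{s<..<N}. \<nu> j i)"

definition sum_inv :: "nat \<Rightarrow> (nat \<Rightarrow> nat \<Rightarrow> real^'d^'d) \<Rightarrow> nat \<Rightarrow> real^'d^'d" where
  "sum_inv N H i = (\<Sum>s<N. matrix_inv (H s i))"

definition W_mat ::
  "nat \<Rightarrow> nat \<Rightarrow> (nat \<Rightarrow> real) \<Rightarrow> (nat \<Rightarrow> nat \<Rightarrow> real^'d^'d) \<Rightarrow> real^'d^'d" where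
  "W_mat N M w H = (\<Sum>i=1..M. w i *\<^sub>R matrix_inv (sum_inv N H i))"

definition V_vec ::
  "nat \<Rightarrow> nat \<Rightarrow> (nat \<Rightarrow> real^'d) \<Rightarrow> (nat \<Rightarrow> real) \<Rightarrow>
   (nat \<Rightarrow> nat \<Rightarrow> real^'d^'d) \<Rightarrow> (nat \<Rightarrow> nat \<Rightarrow> real^'d) \<Rightarrow> real^'d" where
  "V_vec N M a w H \<nu> =
     (\<Sum>i=1..M. w i *\<^sub>R (matrix_inv (sum_inv N H i) *v a i)) -
     (1/2) *\<^sub>R (\<Sum>i=1..M. matrix_inv (sum_inv N H i) *v
                   (\<Sum>s<N. matrix_inv (H s i) *v nu_tail N \<nu> s i))"

text \<open>
  The scheme determines \<open>\<mu> s i\<close> only for \<open>s = N - 1\<close> and \<open>z s i\<close> only for \<open>s < N\<close>; a solution of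
  \<open>frozen_system\<close> additionally has \<open>\<mu> s i = \<mu> (N - 1) i + nu_tail N \<nu> s i\<close> and \<open>z N i = y\<close>.
\<close>

definition update_scheme ::
  "nat \<Rightarrow> nat \<Rightarrow> (nat \<Rightarrow> real^'d) \<Rightarrow> (nat \<Rightarrow> real) \<Rightarrow>
   (nat \<Rightarrow> nat \<Rightarrow> real^'d^'d) \<Rightarrow> (nat \<Rightarrow> nat \<Rightarrow> real^'d) \<Rightarrow> real^'d \<Rightarrow>
   (nat \<Rightarrow> nat \<Rightarrow> real^'d) \<Rightarrow> (nat \<Rightarrow> nat \<Rightarrow> real^'d) \<Rightarrow> (nat \<Rightarrow> nat \<Rightarrow> real^'d) \<Rightarrow> bool" where
  "update_scheme N M a w H \<nu> y z u \<mu> \<longleftrightarrow>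
     y = matrix_inv (W_mat N M w H) *v V_vec N M a w H \<nu> \<and>
     (\<forall>i\<in>{1..M}. \<mu> (N - 1) i =
        matrix_inv (sum_inv N H i) *v
          ((2 * w i) *\<^sub>R (a i - y) - (\<Sum>s<N. matrix_inv (H s i) *v nu_tail N \<nu> s i))) \<and>
     (\<forall>i\<in>{1..M}. \<forall>s\<in>{0..<N}. u s i =
        - (1 / (2 * w i)) *\<^sub>R (matrix_inv (H s i) *v (\<mu> (N - 1) i + nu_tail N \<nu> s i))) \<and>
     (\<forall>i\<in>{1..M}. \<forall>s\<in>{0..<N - 1}. z (s + 1) i = z s i + u s i) \<and>
     (\<forall>i\<in>{1..M}. z 0 i = a i)"

end

theory Submission
  imports Defs
begin

text \<open>
  Feasible variations of a local minimizer move one interior state \<open>z s i\<close>, compensating in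
  \<open>u (s - 1) i\<close> and \<open>u s i\<close>, or the common endpoint, compensating in all \<open>u (N - 1) i\<close>.  With
  \<open>\<mu> s i = - 2 w\<^sub>i G(z s i) u s i\<close>, vanishing of the cost derivative along them gives the costate
  recursion and \<open>\<Sum>\<^sub>i \<mu> (N - 1) i = 0\<close>.  For frozen coefficients the recursion telescopes to
  \<open>\<mu> s i = \<mu> (N - 1) i + \<Sum>\<^sub>j\<^sub>>\<^sub>s \<nu> j i\<close>; summing the dynamics expresses \<open>\<mu> (N - 1) i\<close> affinely in
  \<open>y\<close>, and the transversality condition becomes \<open>W y = V\<close>.  All matrices to be inverted are
  positive definite.
\<close>

subsection \<open>Positive definite matrices\<close>

text \<open>Only the quadratic form is constrained. Symmetry is kept apart, because it enters
  through differentiation of the form and not through inversion.\<close>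

definition pos_def :: "real^'n^'n \<Rightarrow> bool" where
  "pos_def A \<longleftrightarrow> (\<forall>v. v \<noteq> 0 \<longrightarrow> v \<bullet> (A *v v) > 0)"

text \<open>A nonzero kernel vector would make the quadratic form vanish, and a square matrix with
  trivial kernel is invertible.\<close>

lemma pos_def_invertible:
  fixes A :: "real^'n^'n"
  assumes "pos_def A"
  shows "invertible A"
proof -
  have "x = 0" if "A *v x = 0" for x
    using assms that unfolding pos_def_def by fastforce
  then show ?thesis
    using matrix_left_invertible_ker invertible_left_inverse by blast
qed

lemma invertible_matrix_inv_vector:
  fixes A :: "real^'n^'n"
  assumes "invertible A"
  shows "A *v (matrix_inv A *v x) = x" and "matrix_inv A *v (A *v x) = x"
proof -
  have "A ** matrix_inv A = mat 1 \<and> matrix_inv A ** A = mat 1"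
    using assms unfolding invertible_def matrix_inv_def by (rule someI_ex)
  then show "A *v (matrix_inv A *v x) = x" "matrix_inv A *v (A *v x) = x"
    by (simp_all add: matrix_vector_mul_assoc)
qed

text \<open>Each closed formula of the scheme is traded for a linear equation in this form.\<close>

lemma matrix_inv_vector_eq_iff:
  fixes A :: "real^'n^'n"
  assumes "invertible A"
  shows "x = matrix_inv A *v b \<longleftrightarrow> A *v x = b"
  using invertible_matrix_inv_vector[OF assms] by metis

text \<open>The substitution \<open>v = A *v x\<close> turns the form of the inverse at
  \<open>v\<close> into the form of \<open>A\<close> at \<open>x\<close>, and \<open>x\<close> is
  nonzero because \<open>v\<close> is.\<close>

lemma pos_def_matrix_inv:
  fixes A :: "real^'n^'n"
  assumes "pos_def A"
  shows "pos_def (matrix_inv A)"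
  unfolding pos_def_def
proof (intro allI impI)
  fix v :: "real^'n"
  assume "v \<noteq> 0"
  note inv = invertible_matrix_inv_vector[OF pos_def_invertible[OF assms]]
  have "matrix_inv A *v v \<noteq> 0"
    using inv(1)[of v] \<open>v \<noteq> 0\<close> by auto
  then show "v \<bullet> (matrix_inv A *v v) > 0"
    using assms inv(1)[of v] unfolding pos_def_def by (metis inner_commute)
qed

lemma pos_def_scaleR:
  fixes A :: "real^'n^'n"
  assumes "pos_def A" and "c > 0"
  shows "pos_def (c *\<^sub>R A)"
  using assms by (simp add: pos_def_def flip: scaleR_matrix_vector_assoc)

lemma sum_matrix_vector_mult:
  fixes A :: "'a \<Rightarrow> real^'n^'m"
  shows "(\<Sum>k\<in>K. A k) *v x = (\<Sum>k\<in>K. A k *v x)"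
  by (induction K rule: infinite_finite_induct) (simp_all add: matrix_vector_mult_add_rdistrib)

text \<open>The empty sum is the zero matrix, so the index set must be nonempty;
  \<open>N \<ge> 1\<close> and \<open>M \<ge> 1\<close> supply this for \<open>sum_inv\<close> and
  \<open>W_mat\<close>.\<close>

lemma pos_def_sum:
  fixes A :: "'a \<Rightarrow> real^'n^'n"
  assumes "finite K" and "K \<noteq> {}" and "\<And>k. k \<in> K \<Longrightarrow> pos_def (A k)"
  shows "pos_def (\<Sum>k\<in>K. A k)"
  using assms
  by (auto simp: pos_def_def sum_matrix_vector_mult inner_sum_right intro!: sum_pos)

subsection \<open>The frozen system\<close>

lemma nu_tail_step: "Suc s < N \<Longrightarrow> nu_tail N \<nu> s i = \<nu> (Suc s) i + nu_tail N \<nu> (Suc s) i"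
proof -
  assume "Suc s < N"
  then have "{s<..<N} = insert (Suc s) {Suc s<..<N}"
    by auto
  then show ?thesis
    by (simp add: nu_tail_def)
qed

text \<open>Written with \<open>Suc 0\<close>, the form to which the simplifier brings
  \<open>N - 1\<close>.\<close>

lemma nu_tail_last: "nu_tail N \<nu> (N - Suc 0) i = 0"
proof -
  have "{N - Suc 0<..<N} = {}"
    by auto
  then show ?thesis
    by (simp add: nu_tail_def)
qed

text \<open>Going down from \<open>N - 1\<close>, where the tail is empty, each step adds one
  \<open>\<nu>\<close>; conversely, consecutive closed forms differ by exactly one
  \<open>\<nu>\<close>. The terminal multiplier stays a free parameter.\<close>

lemma multiplier_recursion_iff:
  assumes "N \<ge> 1"
  shows "(\<forall>s\<in>{1..<N}. \<nu> s i + \<mu> s i = \<mu> (s - 1) i) \<longleftrightarrow>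
    (\<forall>s\<in>{0..<N}. \<mu> s i = \<mu> (N - 1) i + nu_tail N \<nu> s i)" (is "?rec \<longleftrightarrow> ?closed")
proof
  assume rec: ?rec
  have "\<mu> s i = \<mu> (N - 1) i + nu_tail N \<nu> s i" if "s \<le> N - 1" for s
    using that
  proof (induction rule: inc_induct)
    case base
    show ?case by (simp add: nu_tail_last)
  next
    case (step s)
    then have "\<mu> s i = \<nu> (Suc s) i + \<mu> (Suc s) i"
      using bspec[OF rec, of "Suc s"] by simp
    also have "\<dots> = \<mu> (N - 1) i + nu_tail N \<nu> s i"
      using step nu_tail_step[of s N \<nu> i] by simp
    finally show ?case .
  qed
  moreover have "s \<le> N - 1" if "s \<in> {0..<N}" for s
    using that by simp
  ultimately show ?closed by blast
next
  assume closed: ?closed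
  show ?rec
  proof
    fix s assume s: "s \<in> {1..<N}"
    then have "\<mu> s i = \<mu> (N - 1) i + nu_tail N \<nu> s i"
      "\<mu> (s - 1) i = \<mu> (N - 1) i + nu_tail N \<nu> (s - 1) i"
      using bspec[OF closed, of s] bspec[OF closed, of "s - 1"] by auto
    then show "\<nu> s i + \<mu> s i = \<mu> (s - 1) i"
      using s nu_tail_step[of "s - 1" N \<nu> i] by simp
  qed
qed

lemma trajectory_eq_sum:
  fixes z u :: "nat \<Rightarrow> nat \<Rightarrow> real^'d"
  assumes "\<forall>s\<in>{0..<n}. z (s + 1) i = z s i + u s i"
  shows "z n i = z 0 i + (\<Sum>s<n. u s i)"
  using assms by (induction n) (auto simp: add.assoc)

lemma control_eq_iff:
  fixes H :: "real^'d^'d"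
  assumes "invertible H" and "c > 0"
  shows "c *\<^sub>R (H *v u) + m = 0 \<longleftrightarrow> u = - (1 / c) *\<^sub>R (matrix_inv H *v m)"
proof -
  have "c *\<^sub>R (H *v u) + m = 0 \<longleftrightarrow> c *\<^sub>R (H *v u) = - m"
    by (simp add: eq_neg_iff_add_eq_0)
  also have "\<dots> \<longleftrightarrow> H *v u = - (1 / c) *\<^sub>R m"
    using assms(2) by (metis (no_types, opaque_lifting) divideR_right less_irrefl
        scaleR_minus_left scaleR_minus_right inverse_eq_divide)
  also have "\<dots> \<longleftrightarrow> u = matrix_inv H *v (- (1 / c) *\<^sub>R m)"
    using matrix_inv_vector_eq_iff[OF assms(1)] by auto
  also have "\<dots> \<longleftrightarrow> u = - (1 / c) *\<^sub>R (matrix_inv H *v m)"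
    by (simp only: matrix_vector_mult_scaleR)
  finally show ?thesis .
qed

text \<open>With the controls expressed through an unknown terminal multiplier \<open>m\<close>,
  hitting \<open>y\<close> is a linear equation for \<open>m\<close>. Here \<open>P s\<close> stands
  for an inverse metric matrix, \<open>T s\<close> for a tail of \<open>\<nu>\<close> and
  \<open>c\<close> for \<open>2 * w i\<close>.\<close>

lemma endpoint_eq_iff:
  fixes P :: "nat \<Rightarrow> real^'d^'d" and T :: "nat \<Rightarrow> real^'d"
  assumes "invertible (\<Sum>s<N. P s)" and "c > 0"
  shows "x + (\<Sum>s<N. - (1 / c) *\<^sub>R (P s *v (m + T s))) = y \<longleftrightarrow>
    m = matrix_inv (\<Sum>s<N. P s) *v (c *\<^sub>R (x - y) - (\<Sum>s<N. P s *v T s))"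
proof -
  have "(\<Sum>s<N. - (1 / c) *\<^sub>R (P s *v (m + T s))) =
      - (1 / c) *\<^sub>R ((\<Sum>s<N. P s) *v m + (\<Sum>s<N. P s *v T s))"
    by (simp add: sum_matrix_vector_mult matrix_vector_right_distrib sum.distrib
        scaleR_sum_right scaleR_right_distrib sum_negf sum_subtractf)
  moreover have "x + - (1 / c) *\<^sub>R q = y \<longleftrightarrow> q = c *\<^sub>R (x - y)" for q
  proof -
    have "x + - (1 / c) *\<^sub>R q = y \<longleftrightarrow> (1 / c) *\<^sub>R q = x - y"
      by (auto simp: algebra_simps)
    also have "\<dots> \<longleftrightarrow> q = c *\<^sub>R (x - y)"
    proof
      assume "(1 / c) *\<^sub>R q = x - y"
      then have "c *\<^sub>R (1 / c) *\<^sub>R q = c *\<^sub>R (x - y)"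
        by simp
      then show "q = c *\<^sub>R (x - y)"
        using assms(2) by simp
    qed (use assms(2) in simp)
    finally show ?thesis .
  qed
  ultimately have "x + (\<Sum>s<N. - (1 / c) *\<^sub>R (P s *v (m + T s))) = y \<longleftrightarrow>
      (\<Sum>s<N. P s) *v m + (\<Sum>s<N. P s *v T s) = c *\<^sub>R (x - y)"
    by simp
  also have "\<dots> \<longleftrightarrow> (\<Sum>s<N. P s) *v m = c *\<^sub>R (x - y) - (\<Sum>s<N. P s *v T s)"
    by (simp add: eq_diff_eq)
  finally show ?thesis
    using matrix_inv_vector_eq_iff[OF assms(1)] by simp
qed

text \<open>The equations match one by one: the control equation gives the formula for
  \<open>u\<close>, the endpoint condition that for \<open>\<mu> (N - 1)\<close>, and the vanishing
  sum of terminal multipliers that for \<open>y\<close>. The last two conjuncts fix what the scheme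
  itself leaves open.\<close>

lemma frozen_system_iff_update_scheme:
  fixes H :: "nat \<Rightarrow> nat \<Rightarrow> real^'d^'d"
  assumes "N \<ge> 1"
    and w: "\<And>i. i \<in> {1..M} \<Longrightarrow> w i > 0"
    and H: "\<And>s i. s < N \<Longrightarrow> i \<in> {1..M} \<Longrightarrow> invertible (H s i)"
    and Q: "\<And>i. i \<in> {1..M} \<Longrightarrow> invertible (sum_inv N H i)"
    and W: "invertible (W_mat N M w H)"
  shows "frozen_system N M a w H \<nu> y z u \<mu> \<longleftrightarrow>
    update_scheme N M a w H \<nu> y z u \<mu> \<and>
    (\<forall>i\<in>{1..M}. z N i = y) \<and>
    (\<forall>i\<in>{1..M}. \<forall>s\<in>{0..<N}. \<mu> s i = \<mu> (N - 1) i + nu_tail N \<nu> s i)"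
proof -
  let ?T = "nu_tail N \<nu>"
  let ?R = "\<lambda>i. \<Sum>s<N. matrix_inv (H s i) *v ?T s i"
  let ?m = "\<lambda>i. matrix_inv (sum_inv N H i) *v ((2 * w i) *\<^sub>R (a i - y) - ?R i)"
  have u_iff: "(2 * w i) *\<^sub>R (H s i *v u s i) + m = 0 \<longleftrightarrow>
      u s i = - (1 / (2 * w i)) *\<^sub>R (matrix_inv (H s i) *v m)"
    if "i \<in> {1..M}" "s < N" for i s m
    using control_eq_iff[OF H[OF that(2,1)], of "2 * w i" "u s i" m] w[OF that(1)] by simp
  have m_iff: "a i + (\<Sum>s<N. u s i) = y \<longleftrightarrow> m = ?m i"
    if "i \<in> {1..M}"
      and "\<And>s. s < N \<Longrightarrow> u s i = - (1 / (2 * w i)) *\<^sub>R (matrix_inv (H s i) *v (m + ?T s i))"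
    for i m
    using endpoint_eq_iff[where P="\<lambda>s. matrix_inv (H s i)" and N=N and c="2 * w i"
        and x="a i" and T="\<lambda>s. ?T s i" and m=m and y=y]
      Q[OF that(1)] w[OF that(1)] that(2) by (simp add: sum_inv_def)
  \<comment> \<open>The factor 2 comes from \<open>2 * w i\<close> and cancels the
    \<open>1/2\<close> in \<open>V_vec\<close>; the sum vanishes exactly when
    \<open>W y = V\<close>.\<close>
  have "(\<Sum>i=1..M. ?m i) =
      2 *\<^sub>R (V_vec N M a w H \<nu> - W_mat N M w H *v y)"
  proof -
    have "?m i = 2 *\<^sub>R (w i *\<^sub>R (matrix_inv (sum_inv N H i) *v a i)
        - (1/2) *\<^sub>R (matrix_inv (sum_inv N H i) *v ?R i)
        - (w i *\<^sub>R matrix_inv (sum_inv N H i)) *v y)" for i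
      by (simp add: matrix_vector_mult_diff_distrib matrix_vector_mult_scaleR
          scaleR_diff_right scaleR_scaleR flip: scaleR_matrix_vector_assoc)
    then show ?thesis
      by (simp add: V_vec_def W_mat_def sum_matrix_vector_mult sum_subtractf
          scaleR_sum_right scaleR_diff_right)
  qed
  then have y_iff: "(\<Sum>i=1..M. ?m i) = 0 \<longleftrightarrow> y = matrix_inv (W_mat N M w H) *v V_vec N M a w H \<nu>"
    using matrix_inv_vector_eq_iff[OF W, of y "V_vec N M a w H \<nu>"] by auto
  have rec_iff: "(\<forall>i\<in>{1..M}. \<forall>s\<in>{1..<N}. \<nu> s i + \<mu> s i = \<mu> (s - 1) i) \<longleftrightarrow>
      (\<forall>i\<in>{1..M}. \<forall>s\<in>{0..<N}. \<mu> s i = \<mu> (N - 1) i + ?T s i)"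
    by (intro ball_cong refl multiplier_recursion_iff assms(1))
  show ?thesis (is "?L \<longleftrightarrow> ?R1 \<and> ?zN \<and> ?\<mu>")
  proof
    assume L: ?L
    have \<mu>: ?\<mu>
      using L unfolding rec_iff[symmetric] frozen_system_def by blast
    have u: "u s i = - (1 / (2 * w i)) *\<^sub>R (matrix_inv (H s i) *v (\<mu> (N - 1) i + ?T s i))"
      if "i \<in> {1..M}" "s < N" for i s
    proof -
      have "\<mu> s i = \<mu> (N - 1) i + ?T s i"
        using bspec[OF bspec[OF \<mu> that(1)], of s] that(2) by simp
      moreover have "(2 * w i) *\<^sub>R (H s i *v u s i) + \<mu> s i = 0"
        using L that by (simp add: frozen_system_def)
      ultimately show ?thesis
        using u_iff[OF that, of "\<mu> s i"] by metis
    qed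
    have m: "\<mu> (N - 1) i = ?m i" if "i \<in> {1..M}" for i
    proof -
      have "z N i = z 0 i + (\<Sum>s<N. u s i)"
        using L that by (intro trajectory_eq_sum) (simp add: frozen_system_def)
      then show ?thesis
        using m_iff[OF that u[OF that]] L that by (simp add: frozen_system_def)
    qed
    have "(\<Sum>i=1..M. \<mu> (N - 1) i) = 0"
      using L by (simp add: frozen_system_def)
    then have "y = matrix_inv (W_mat N M w H) *v V_vec N M a w H \<nu>"
      using m unfolding y_iff[symmetric] by (metis (no_types, lifting) sum.cong)
    then have ?R1
      using L u m by (simp add: frozen_system_def update_scheme_def)
    moreover have ?zN
      using L by (simp add: frozen_system_def)
    ultimately show "?R1 \<and> ?zN \<and> ?\<mu>"
      using \<mu> by blast
  next
    assume "?R1 \<and> ?zN \<and> ?\<mu>"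
    then have R1: ?R1 and zN: ?zN and \<mu>: ?\<mu>
      by blast+
    have u: "u s i = - (1 / (2 * w i)) *\<^sub>R (matrix_inv (H s i) *v (\<mu> (N - 1) i + ?T s i))"
      if "i \<in> {1..M}" "s < N" for i s
      using R1 that by (simp add: update_scheme_def)
    have m: "\<mu> (N - 1) i = ?m i" if "i \<in> {1..M}" for i
      using R1 that by (simp add: update_scheme_def)
    have dyn: "z (s + 1) i = z s i + u s i" if "i \<in> {1..M}" "s < N" for i s
    proof (cases "s < N - 1")
      case True
      then show ?thesis
        using R1 that by (simp add: update_scheme_def)
    next
      \<comment> \<open>The scheme propagates states only up to index \<open>N - 1\<close>. The last
        dynamics equation is recovered from \<open>z N i = y\<close>, since the formula for the
        terminal multiplier makes the controls add up to \<open>y - a i\<close>.\<close>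
      case False
      with that have s: "s = N - 1" "s + 1 = N"
        by auto
      have "z (N - 1) i = z 0 i + (\<Sum>s<N - 1. u s i)"
        using R1 that by (intro trajectory_eq_sum) (simp add: update_scheme_def)
      moreover have "(\<Sum>s<N. u s i) = (\<Sum>s<N - 1. u s i) + u (N - 1) i"
        using s by (metis Suc_eq_plus1 sum.lessThan_Suc)
      moreover have "a i + (\<Sum>s<N. u s i) = y"
        using m_iff[OF that(1) u[OF that(1)]] m[OF that(1)] by simp
      moreover have "z 0 i = a i"
        using R1 that by (simp add: update_scheme_def)
      moreover have "z N i = y"
        using zN that by simp
      ultimately have "z N i = z (N - 1) i + u (N - 1) i"
        by (metis add.assoc)
      then show ?thesis
        using s by metis
    qed
    have "(2 * w i) *\<^sub>R (H s i *v u s i) + \<mu> s i = 0" if "i \<in> {1..M}" "s < N" for i s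
    proof -
      have "\<mu> s i = \<mu> (N - 1) i + ?T s i"
        using bspec[OF bspec[OF \<mu> that(1)], of s] that(2) by simp
      then show ?thesis
        using u_iff[OF that, of "\<mu> s i"] u[OF that] by metis
    qed
    moreover have "(\<Sum>i=1..M. \<mu> (N - 1) i) = 0"
    proof -
      have "(\<Sum>i=1..M. \<mu> (N - 1) i) = (\<Sum>i=1..M. ?m i)"
        using m by (intro sum.cong refl)
      then show ?thesis
        using R1 y_iff by (simp add: update_scheme_def)
    qed
    ultimately show ?L
      using R1 zN \<mu>[folded rec_iff] dyn unfolding frozen_system_def update_scheme_def by simp
  qed
qed

text \<open>The witnesses follow the order of the scheme: endpoint, terminal multipliers, all
  multipliers by the telescoped formula, controls, and states as partial sums of the
  controls.\<close>

lemma frozen_system_solvable: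
  fixes H :: "nat \<Rightarrow> nat \<Rightarrow> real^'d^'d"
  assumes "N \<ge> 1"
    and w: "\<And>i. i \<in> {1..M} \<Longrightarrow> w i > 0"
    and H: "\<And>s i. s < N \<Longrightarrow> i \<in> {1..M} \<Longrightarrow> invertible (H s i)"
    and Q: "\<And>i. i \<in> {1..M} \<Longrightarrow> invertible (sum_inv N H i)"
    and W: "invertible (W_mat N M w H)"
  shows "\<exists>y z u \<mu>. frozen_system N M a w H \<nu> y z u \<mu>"
proof -
  define y where "y = matrix_inv (W_mat N M w H) *v V_vec N M a w H \<nu>"
  define m where "m i = matrix_inv (sum_inv N H i) *v ((2 * w i) *\<^sub>R (a i - y) -
      (\<Sum>s<N. matrix_inv (H s i) *v nu_tail N \<nu> s i))" for i
  define \<mu> where "\<mu> s i = m i + nu_tail N \<nu> s i" for s i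
  define u where "u s i = - (1 / (2 * w i)) *\<^sub>R (matrix_inv (H s i) *v \<mu> s i)" for s i
  define z where "z s i = a i + (\<Sum>t<s. u t i)" for s i
  have last: "\<mu> (N - 1) i = m i" for i
    by (simp add: \<mu>_def nu_tail_last)
  \<comment> \<open>Arrival at \<open>y\<close> is the one condition not built into the definitions;
    it is equivalent to the choice of \<open>m\<close>.\<close>
  have "a i + (\<Sum>s<N. u s i) = y" if "i \<in> {1..M}" for i
    using endpoint_eq_iff[where P="\<lambda>s. matrix_inv (H s i)" and N=N and c="2 * w i"
        and x="a i" and T="\<lambda>s. nu_tail N \<nu> s i" and m="m i" and y=y]
      Q[OF that] w[OF that] by (simp add: sum_inv_def u_def \<mu>_def m_def)
  then have "update_scheme N M a w H \<nu> y z u \<mu> \<and> (\<forall>i\<in>{1..M}. z N i = y) \<and>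
      (\<forall>i\<in>{1..M}. \<forall>s\<in>{0..<N}. \<mu> s i = \<mu> (N - 1) i + nu_tail N \<nu> s i)"
    unfolding update_scheme_def last
    by (auto simp: z_def y_def[symmetric] m_def[symmetric] u_def \<mu>_def)
  then have "frozen_system N M a w H \<nu> y z u \<mu>"
    by (subst frozen_system_iff_update_scheme[OF assms(1) w H Q W])
  then show ?thesis by blast
qed

subsection \<open>Stationarity\<close>

text \<open>Bilinear maps between finite-dimensional spaces are bounded; this yields the product
  rule for \<open>A *v x\<close> registered below.\<close>

lemma bounded_bilinear_matrix_vector_mult:
  "bounded_bilinear (\<lambda>(A :: real^'n^'m) x. A *v x)"
  unfolding bilinear_conv_bounded_bilinear[symmetric] bilinear_def
  by (auto intro!: linearI simp: algebra_simps scaleR_matrix_vector_assoc)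

lemmas has_derivative_matrix_vector_mult [derivative_intros] =
  bounded_bilinear.FDERIV[OF bounded_bilinear_matrix_vector_mult]

lemma inner_symmetric_matrix:
  fixes A :: "real^'n^'n"
  assumes "transpose A = A"
  shows "x \<bullet> (A *v y) = (A *v x) \<bullet> y"
  by (metis assms dot_lmul_matrix transpose_matrix_vector)

text \<open>The derivative is unique as a linear map; testing it on \<open>D - E\<close> separates
  the two vectors.\<close>

lemma GDERIV_unique:
  assumes "GDERIV f x :> D" and "GDERIV f x :> E"
  shows "D = E"
proof -
  have "(\<lambda>h. h \<bullet> D) = (\<lambda>h. h \<bullet> E)"
    using assms unfolding gderiv_def by (rule has_derivative_unique)
  then have "(D - E) \<bullet> D = (D - E) \<bullet> E"
    by (rule fun_cong)
  then have "(D - E) \<bullet> (D - E) = 0"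
    by (simp add: inner_diff_right)
  then show ?thesis by simp
qed

text \<open>The derivative is a linear functional, and its adjoint applied to 1 is the vector
  representing it.\<close>

lemma stage_cost_has_gradient:
  fixes G :: "real^'d \<Rightarrow> real^'d^'d"
  assumes "G differentiable (at z)" and "S differentiable (at z)"
  obtains g where "GDERIV (\<lambda>x. stage_cost G S \<omega> \<rho> x v) z :> g"
proof -
  obtain G' S' where G': "(G has_derivative G') (at z)" and S': "(S has_derivative S') (at z)"
    using assms unfolding differentiable_def by blast
  have "((\<lambda>x. stage_cost G S \<omega> \<rho> x v) has_derivative
      (\<lambda>h. \<omega> * (v \<bullet> (G' h *v v)) + \<rho> * S' h)) (at z)" (is "(_ has_derivative ?D) _")
    unfolding stage_cost_def by (auto intro!: derivative_eq_intros G' S')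
  moreover from this have "?D = (\<lambda>h. h \<bullet> adjoint ?D 1)"
    using adjoint_works[OF has_derivative_linear, of ?D _ _ _ 1] by fastforce
  ultimately have "GDERIV (\<lambda>x. stage_cost G S \<omega> \<rho> x v) z :> adjoint ?D 1"
    unfolding gderiv_def by metis
  then show thesis by (rule that)
qed

text \<open>State and control move together with the vector parameter \<open>x\<close>, at rates
  \<open>\<alpha>\<close> and \<open>\<beta>\<close>. By symmetry of \<open>G z\<close> the two
  control terms of the product rule coincide, whence the factor 2.\<close>

lemma GDERIV_stage_cost_line:
  fixes G :: "real^'d \<Rightarrow> real^'d^'d"
  assumes sym: "transpose (G z) = G z"
    and "G differentiable (at z)" and "S differentiable (at z)"
    and g: "GDERIV (\<lambda>x. stage_cost G S \<omega> \<rho> x v) z :> g"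
  shows "GDERIV (\<lambda>x. stage_cost G S \<omega> \<rho> (z + \<alpha> *\<^sub>R (x - c)) (v + \<beta> *\<^sub>R (x - c))) c :>
    \<alpha> *\<^sub>R g + \<beta> *\<^sub>R (2 * \<omega>) *\<^sub>R (G z *v v)"
proof -
  obtain G' S' where G': "(G has_derivative G') (at z)" and S': "(S has_derivative S') (at z)"
    using assms(2,3) unfolding differentiable_def by blast
  have "((\<lambda>x. stage_cost G S \<omega> \<rho> x v) has_derivative
      (\<lambda>h. \<omega> * (v \<bullet> (G' h *v v)) + \<rho> * S' h)) (at z)"
    unfolding stage_cost_def by (auto intro!: derivative_eq_intros G' S')
  then have "(\<lambda>h. \<omega> * (v \<bullet> (G' h *v v)) + \<rho> * S' h) = (\<lambda>h. h \<bullet> g)"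
    using g unfolding gderiv_def by (rule has_derivative_unique)
  \<comment> \<open>The given gradient \<open>g\<close> is expressed through the derivatives of
    \<open>G\<close> and \<open>S\<close>, the form in which the chain rule below delivers the state
    part.\<close>
  then have gh: "\<omega> * (v \<bullet> (G' h *v v)) + \<rho> * S' h = h \<bullet> g" for h
    by meson
  let ?p = "\<lambda>x. z + \<alpha> *\<^sub>R (x - c)"
  have p: "(?p has_derivative (\<lambda>h. \<alpha> *\<^sub>R h)) (at c)"
    by (auto intro!: derivative_eq_intros)
  have Gp: "((\<lambda>x. G (?p x)) has_derivative (\<lambda>h. G' (\<alpha> *\<^sub>R h))) (at c)"
    using has_derivative_compose[OF p, of G G'] G' by simp
  have Sp: "((\<lambda>x. S (?p x)) has_derivative (\<lambda>h. S' (\<alpha> *\<^sub>R h))) (at c)"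
    using has_derivative_compose[OF p, of S S'] S' by simp
  have "((\<lambda>x. stage_cost G S \<omega> \<rho> (?p x) (v + \<beta> *\<^sub>R (x - c))) has_derivative
      (\<lambda>h. \<omega> * (v \<bullet> (G z *v (\<beta> *\<^sub>R h) + G' (\<alpha> *\<^sub>R h) *v v) + (\<beta> *\<^sub>R h) \<bullet> (G z *v v))
        + \<rho> * S' (\<alpha> *\<^sub>R h))) (at c)"
    unfolding stage_cost_def by (auto intro!: derivative_eq_intros Gp Sp)
  moreover have "\<omega> * (v \<bullet> (G z *v (\<beta> *\<^sub>R h) + G' (\<alpha> *\<^sub>R h) *v v) + (\<beta> *\<^sub>R h) \<bullet> (G z *v v))
        + \<rho> * S' (\<alpha> *\<^sub>R h) = h \<bullet> (\<alpha> *\<^sub>R g + \<beta> *\<^sub>R (2 * \<omega>) *\<^sub>R (G z *v v))" for h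
    using gh[of "\<alpha> *\<^sub>R h"] inner_symmetric_matrix[OF sym, of v h]
    by (simp add: inner_add_right matrix_vector_mult_scaleR distrib_left inner_commute)
  ultimately show ?thesis
    unfolding gderiv_def by simp
qed

lemma GDERIV_sum:
  assumes "\<And>k. k \<in> K \<Longrightarrow> GDERIV (f k) x :> D k"
  shows "GDERIV (\<lambda>x. \<Sum>k\<in>K. f k x) x :> (\<Sum>k\<in>K. D k)"
  using assms unfolding gderiv_def by (simp add: inner_sum_right has_derivative_sum)

text \<open>One formula serves both the variations of a minimizer and the partial derivatives. The
  coefficient of \<open>\<mu> s i\<close> is the rate of change of the dynamics residual; it
  vanishes exactly for variations that preserve the dynamics.\<close>

lemma GDERIV_lagrangian_line:
  fixes G :: "real^'d \<Rightarrow> real^'d^'d"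
  assumes "\<And>s i. s < N \<Longrightarrow> i \<in> {1..M} \<Longrightarrow> transpose (G (z s i)) = G (z s i)"
    and "\<And>s i. s < N \<Longrightarrow> i \<in> {1..M} \<Longrightarrow> G differentiable (at (z s i))"
    and "\<And>s i. s < N \<Longrightarrow> i \<in> {1..M} \<Longrightarrow> S differentiable (at (z s i))"
    and "\<And>s i. s < N \<Longrightarrow> i \<in> {1..M} \<Longrightarrow>
      GDERIV (\<lambda>x. stage_cost G S (w i) (\<rho> i) x (u s i)) (z s i) :> g s i"
  shows "GDERIV (\<lambda>x. lagrangian N M G S w \<rho> (\<lambda>s i. z s i + \<alpha> s i *\<^sub>R (x - c))
      (\<lambda>s i. u s i + \<beta> s i *\<^sub>R (x - c)) \<mu>) c :>
    (\<Sum>i=1..M. \<Sum>s<N. \<alpha> s i *\<^sub>R g s i + \<beta> s i *\<^sub>R (2 * w i) *\<^sub>R (G (z s i) *v u s i)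
      + (\<alpha> s i + \<beta> s i - \<alpha> (Suc s) i) *\<^sub>R \<mu> s i)"
proof -
  have lin: "GDERIV (\<lambda>x. \<mu> s i \<bullet> (z s i + \<alpha> s i *\<^sub>R (x - c) + (u s i + \<beta> s i *\<^sub>R (x - c))
      - (z (Suc s) i + \<alpha> (Suc s) i *\<^sub>R (x - c)))) c :>
      (\<alpha> s i + \<beta> s i - \<alpha> (Suc s) i) *\<^sub>R \<mu> s i" for s i
    unfolding gderiv_def
    by (auto intro!: derivative_eq_intros simp: algebra_simps inner_commute)
  show ?thesis
    unfolding lagrangian_def frechet_cost_def sum.distrib[symmetric]
    by (intro GDERIV_sum GDERIV_add GDERIV_stage_cost_line lin assms) auto
qed

text \<open>Updated families and line variations need to agree only inside the index ranges.\<close>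

lemma lagrangian_cong:
  assumes "\<And>s i. s \<le> N \<Longrightarrow> i \<in> {1..M} \<Longrightarrow> z s i = z' s i"
    and "\<And>s i. s < N \<Longrightarrow> i \<in> {1..M} \<Longrightarrow> u s i = u' s i"
  shows "lagrangian N M G S w \<rho> z u \<mu> = lagrangian N M G S w \<rho> z' u' \<mu>"
  unfolding lagrangian_def frechet_cost_def using assms by simp

section \<open>First variation at a local minimizer\<close>

text \<open>Moving the controls by the differences of \<open>\<alpha>\<close> keeps the dynamics;
  \<open>\<alpha> 0 i = 0\<close> keeps the starting points, and the common value \<open>c\<close>
  keeps the endpoints equal. Small variations are therefore feasible, and the cost along them has a
  local minimum at 0.\<close>

lemma local_minimizer_stationary:
  fixes G :: "real^'d \<Rightarrow> real^'d^'d"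
  assumes min: "local_minimizer N M U a G S w \<rho> y z u" and "open U"
    and diff: "\<And>s i. s < N \<Longrightarrow> i \<in> {1..M} \<Longrightarrow> transpose (G (z s i)) = G (z s i)"
      "\<And>s i. s < N \<Longrightarrow> i \<in> {1..M} \<Longrightarrow> G differentiable (at (z s i))"
      "\<And>s i. s < N \<Longrightarrow> i \<in> {1..M} \<Longrightarrow> S differentiable (at (z s i))"
      "\<And>s i. s < N \<Longrightarrow> i \<in> {1..M} \<Longrightarrow>
        GDERIV (\<lambda>x. stage_cost G S (w i) (\<rho> i) x (u s i)) (z s i) :> g s i"
    and \<alpha>: "\<And>i. i \<in> {1..M} \<Longrightarrow> \<alpha> 0 i = 0" "\<And>i. i \<in> {1..M} \<Longrightarrow> \<alpha> N i = c"
  shows "(\<Sum>i=1..M. \<Sum>s<N. \<alpha> s i *\<^sub>R g s i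
      + (\<alpha> (Suc s) i - \<alpha> s i) *\<^sub>R (2 * w i) *\<^sub>R (G (z s i) *v u s i)) = 0" (is "?D = 0")
proof -
  let ?z = "\<lambda>x s i. z s i + \<alpha> s i *\<^sub>R (x - 0)"
  let ?u = "\<lambda>x s i. u s i + (\<alpha> (Suc s) i - \<alpha> s i) *\<^sub>R (x - 0)"
  let ?f = "\<lambda>x. frechet_cost N M G S w \<rho> (?z x) (?u x)"
  \<comment> \<open>With zero multipliers the Lagrangian is the cost itself.\<close>
  have "GDERIV (\<lambda>x. lagrangian N M G S w \<rho> (?z x) (?u x) (\<lambda>_ _. 0)) 0 :>
      (\<Sum>i=1..M. \<Sum>s<N. \<alpha> s i *\<^sub>R g s i
        + (\<alpha> (Suc s) i - \<alpha> s i) *\<^sub>R (2 * w i) *\<^sub>R (G (z s i) *v u s i)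
        + (\<alpha> s i + (\<alpha> (Suc s) i - \<alpha> s i) - \<alpha> (Suc s) i) *\<^sub>R 0)"
    by (rule GDERIV_lagrangian_line) (use diff in auto)
  then have f: "(?f has_derivative (\<lambda>h. h \<bullet> ?D)) (at 0)"
    by (simp add: lagrangian_def gderiv_def)
  obtain \<epsilon> where "\<epsilon> > 0" and feas: "feasible N M U a y z u" and
    \<epsilon>: "\<And>y' z' u'. feasible N M U a y' z' u' \<Longrightarrow>
        \<forall>i\<in>{1..M}. (\<forall>s\<le>N. dist (z' s i) (z s i) < \<epsilon>) \<and> (\<forall>s<N. dist (u' s i) (u s i) < \<epsilon>) \<Longrightarrow>
        frechet_cost N M G S w \<rho> z u \<le> frechet_cost N M G S w \<rho> z' u'"
    using min unfolding local_minimizer_def by blast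
  have near: "\<forall>\<^sub>F x in at 0. p + r *\<^sub>R (x - 0) \<in> V" if "open V" "p \<in> V"
    for p :: "real^'d" and r V
  proof (rule topological_tendstoD[OF _ that])
    show "((\<lambda>x. p + r *\<^sub>R (x - 0)) \<longlongrightarrow> p) (at 0)"
      by (auto intro!: tendsto_eq_intros)
  qed
  \<comment> \<open>Finitely many open conditions, each true at 0, hold simultaneously near
    0.\<close>
  have "\<forall>\<^sub>F x in at 0. \<forall>i\<in>{1..M}. (\<forall>s\<in>{..N}. ?z x s i \<in> U \<inter> ball (z s i) \<epsilon>)
      \<and> (\<forall>s\<in>{..<N}. ?u x s i \<in> ball (u s i) \<epsilon>)"
    using feas \<open>open U\<close> \<open>\<epsilon> > 0\<close>
    by (intro eventually_ball_finite ballI eventually_conj near) (auto simp: feasible_def)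
  then have "\<forall>\<^sub>F x in at 0. ?f 0 \<le> ?f x"
  proof eventually_elim
    case (elim x)
    have "feasible N M U a (y + c *\<^sub>R x) (?z x) (?u x)"
      using feas elim \<alpha> by (auto simp: feasible_def algebra_simps)
    then show ?case
      using \<epsilon>[of "y + c *\<^sub>R x" "?z x" "?u x"] elim by (auto simp: dist_commute)
  qed
  then have "(\<lambda>h. h \<bullet> ?D) = (\<lambda>h. 0)"
    by (rule has_derivative_local_min[OF f])
  then have "?D \<bullet> ?D = 0"
    by (rule fun_cong)
  then show ?thesis
    unfolding inner_eq_zero_iff .
qed

section \<open>Double sums with few nonzero terms and partial derivatives\<close>

lemma double_sum_single:
  fixes f :: "nat \<Rightarrow> nat \<Rightarrow> 'a::comm_monoid_add"
  assumes "t < N" and "j \<in> {1..M}"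
    and "\<And>s i. s < N \<Longrightarrow> i \<in> {1..M} \<Longrightarrow> (s, i) \<noteq> (t, j) \<Longrightarrow> f s i = 0"
  shows "(\<Sum>i=1..M. \<Sum>s<N. f s i) = f t j"
proof -
  have "(\<Sum>i=1..M. \<Sum>s<N. f s i) = (\<Sum>i=1..M. if i = j then f t j else 0)"
  proof (rule sum.cong[OF refl])
    fix i assume i: "i \<in> {1..M}"
    have "(\<Sum>s<N. f s i) = (\<Sum>s<N. if s = t then (if i = j then f t j else 0) else 0)"
      using assms(3) i by (intro sum.cong refl) auto
    then show "(\<Sum>s<N. f s i) = (if i = j then f t j else 0)"
      using assms(1) by simp
  qed
  then show ?thesis
    using assms(2) by simp
qed

text \<open>Moving an interior state touches its own stage and the dynamics of the preceding one.
  The bound \<open>1 \<le> t\<close> keeps the two indices distinct, so that the sum splits into two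
  single-term sums.\<close>

lemma double_sum_pair:
  fixes f :: "nat \<Rightarrow> nat \<Rightarrow> 'a::comm_monoid_add"
  assumes "t < N" and "1 \<le> t" and "j \<in> {1..M}"
    and "\<And>s i. s < N \<Longrightarrow> i \<in> {1..M} \<Longrightarrow> (s, i) \<noteq> (t, j) \<Longrightarrow> (s, i) \<noteq> (t - 1, j) \<Longrightarrow> f s i = 0"
  shows "(\<Sum>i=1..M. \<Sum>s<N. f s i) = f (t - 1) j + f t j"
proof -
  let ?e = "\<lambda>k s i. if s = k \<and> i = j then f s i else 0"
  have "(\<Sum>i=1..M. \<Sum>s<N. f s i) = (\<Sum>i=1..M. \<Sum>s<N. ?e (t - 1) s i + ?e t s i)"
    using assms(2,4) by (intro sum.cong refl) auto
  also have "\<dots> = (\<Sum>i=1..M. \<Sum>s<N. ?e (t - 1) s i) + (\<Sum>i=1..M. \<Sum>s<N. ?e t s i)"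
    by (simp add: sum.distrib)
  also have "(\<Sum>i=1..M. \<Sum>s<N. ?e (t - 1) s i) = f (t - 1) j"
    using assms(1,3) by (subst double_sum_single[of "t - 1" N j M]) auto
  also have "(\<Sum>i=1..M. \<Sum>s<N. ?e t s i) = f t j"
    using assms(1,3) by (subst double_sum_single[of t N j M]) auto
  finally show ?thesis .
qed

lemma double_sum_last:
  fixes f :: "nat \<Rightarrow> nat \<Rightarrow> 'a::comm_monoid_add"
  assumes "N \<ge> 1" and "\<And>s i. s < N - 1 \<Longrightarrow> i \<in> {1..M} \<Longrightarrow> f s i = 0"
  shows "(\<Sum>i=1..M. \<Sum>s<N. f s i) = (\<Sum>i=1..M. f (N - 1) i)"
proof -
  obtain n where n: "N = Suc n"
    using assms(1) by (cases N) auto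
  show ?thesis
    using assms(2) unfolding n by (intro sum.cong refl) simp
qed

text \<open>
  All three families of partial derivatives are line derivatives of the Lagrangian:
  \<open>\<alpha>\<close> marks the moved states, \<open>\<beta>\<close> the moved controls.
\<close>

lemma lagrangian_partial_derivatives:
  fixes G :: "real^'d \<Rightarrow> real^'d^'d"
  assumes "N \<ge> 1" and zN: "\<And>i. i \<in> {1..M} \<Longrightarrow> z N i = y"
    and diff: "\<And>s i. s < N \<Longrightarrow> i \<in> {1..M} \<Longrightarrow> transpose (G (z s i)) = G (z s i)"
      "\<And>s i. s < N \<Longrightarrow> i \<in> {1..M} \<Longrightarrow> G differentiable (at (z s i))"
      "\<And>s i. s < N \<Longrightarrow> i \<in> {1..M} \<Longrightarrow> S differentiable (at (z s i))"
      "\<And>s i. s < N \<Longrightarrow> i \<in> {1..M} \<Longrightarrow>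
        GDERIV (\<lambda>x. stage_cost G S (w i) (\<rho> i) x (u s i)) (z s i) :> g s i"
  shows lagrangian_derivative_control: "\<And>s i. s < N \<Longrightarrow> i \<in> {1..M} \<Longrightarrow>
      GDERIV (\<lambda>v. lagrangian N M G S w \<rho> z (upd u s i v) \<mu>) (u s i) :>
        (2 * w i) *\<^sub>R (G (z s i) *v u s i) + \<mu> s i"
    and lagrangian_derivative_state: "\<And>s i. s \<in> {1..<N} \<Longrightarrow> i \<in> {1..M} \<Longrightarrow>
      GDERIV (\<lambda>x. lagrangian N M G S w \<rho> (upd z s i x) u \<mu>) (z s i) :>
        g s i + \<mu> s i - \<mu> (s - 1) i"
    and lagrangian_derivative_endpoint:
      "GDERIV (\<lambda>x. lagrangian N M G S w \<rho> (z(N := (\<lambda>i. x))) u \<mu>) y :> - (\<Sum>i=1..M. \<mu> (N - 1) i)"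
proof -
  note line = GDERIV_lagrangian_line[where N=N and M=M and z=z and u=u and w=w and \<rho>=\<rho>
      and g=g and \<mu>=\<mu>, OF diff]
  {
    fix s i assume si: "s < N" "i \<in> {1..M}"
    let ?\<beta> = "\<lambda>t j. of_bool ((t, j) = (s, i)) :: real"
    have "(\<lambda>v. lagrangian N M G S w \<rho> z (upd u s i v) \<mu>) =
        (\<lambda>v. lagrangian N M G S w \<rho> (\<lambda>t j. z t j + 0 *\<^sub>R (v - u s i))
          (\<lambda>t j. u t j + ?\<beta> t j *\<^sub>R (v - u s i)) \<mu>)"
      by (intro ext lagrangian_cong) (auto simp: upd_def)
    moreover have "(\<Sum>j=1..M. \<Sum>t<N. 0 *\<^sub>R g t j + ?\<beta> t j *\<^sub>R (2 * w j) *\<^sub>R (G (z t j) *v u t j)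
        + (0 + ?\<beta> t j - 0) *\<^sub>R \<mu> t j) = (2 * w i) *\<^sub>R (G (z s i) *v u s i) + \<mu> s i"
      using si by (subst double_sum_single[of s N i M]) auto
    ultimately show "GDERIV (\<lambda>v. lagrangian N M G S w \<rho> z (upd u s i v) \<mu>) (u s i) :>
        (2 * w i) *\<^sub>R (G (z s i) *v u s i) + \<mu> s i"
      using line[where \<alpha>="\<lambda>t j. 0" and c="u s i" and \<beta>="?\<beta>"] by (simp only:)
  next
    fix s i assume si: "s \<in> {1..<N}" "i \<in> {1..M}"
    let ?\<alpha> = "\<lambda>t j. of_bool ((t, j) = (s, i)) :: real"
    have "(\<lambda>x. lagrangian N M G S w \<rho> (upd z s i x) u \<mu>) =
        (\<lambda>x. lagrangian N M G S w \<rho> (\<lambda>t j. z t j + ?\<alpha> t j *\<^sub>R (x - z s i))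
          (\<lambda>t j. u t j + 0 *\<^sub>R (x - z s i)) \<mu>)"
      by (intro ext lagrangian_cong) (auto simp: upd_def)
    moreover have "(\<Sum>j=1..M. \<Sum>t<N. ?\<alpha> t j *\<^sub>R g t j + 0 *\<^sub>R (2 * w j) *\<^sub>R (G (z t j) *v u t j)
        + (?\<alpha> t j + 0 - ?\<alpha> (Suc t) j) *\<^sub>R \<mu> t j) = g s i + \<mu> s i - \<mu> (s - 1) i"
      using si by (subst double_sum_pair[of s N i M]) auto
    ultimately show "GDERIV (\<lambda>x. lagrangian N M G S w \<rho> (upd z s i x) u \<mu>) (z s i) :>
        g s i + \<mu> s i - \<mu> (s - 1) i"
      using line[where \<alpha>="?\<alpha>" and c="z s i" and \<beta>="\<lambda>t j. 0"] by (simp only:)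
  next
    \<comment> \<open>No stage has index \<open>N\<close>; the endpoint enters only through
      \<open>?\<alpha> (Suc t)\<close> at \<open>t = N - 1\<close>, which explains the minus
      sign.\<close>
    let ?\<alpha> = "\<lambda>t j::nat. of_bool (t = N) :: real"
    have "(\<lambda>x. lagrangian N M G S w \<rho> (z(N := (\<lambda>i. x))) u \<mu>) =
        (\<lambda>x. lagrangian N M G S w \<rho> (\<lambda>t j. z t j + ?\<alpha> t j *\<^sub>R (x - y))
          (\<lambda>t j. u t j + 0 *\<^sub>R (x - y)) \<mu>)"
      using zN by (intro ext lagrangian_cong) auto
    moreover have "(\<Sum>j=1..M. \<Sum>t<N. ?\<alpha> t j *\<^sub>R g t j + 0 *\<^sub>R (2 * w j) *\<^sub>R (G (z t j) *v u t j)
        + (?\<alpha> t j + 0 - ?\<alpha> (Suc t) j) *\<^sub>R \<mu> t j) = - (\<Sum>i=1..M. \<mu> (N - 1) i)"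
      using assms(1) by (subst double_sum_last) (auto simp: sum_negf)
    ultimately show "GDERIV (\<lambda>x. lagrangian N M G S w \<rho> (z(N := (\<lambda>i. x))) u \<mu>) y :>
        - (\<Sum>i=1..M. \<mu> (N - 1) i)"
      using line[where \<alpha>="?\<alpha>" and c=y and \<beta>="\<lambda>t j. 0"] by (simp only:)
  }
qed

section \<open>Stationarity as a system of equations\<close>

lemma necessary_conditions_iff:
  fixes G :: "real^'d \<Rightarrow> real^'d^'d"
  assumes "N \<ge> 1"
    and diff: "\<And>s i. s < N \<Longrightarrow> i \<in> {1..M} \<Longrightarrow> transpose (G (z s i)) = G (z s i)"
      "\<And>s i. s < N \<Longrightarrow> i \<in> {1..M} \<Longrightarrow> G differentiable (at (z s i))"
      "\<And>s i. s < N \<Longrightarrow> i \<in> {1..M} \<Longrightarrow> S differentiable (at (z s i))"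
      "\<And>s i. s < N \<Longrightarrow> i \<in> {1..M} \<Longrightarrow>
        GDERIV (\<lambda>x. stage_cost G S (w i) (\<rho> i) x (u s i)) (z s i) :> g s i"
  shows "necessary_conditions N M U a G S w \<rho> y z u \<mu> \<longleftrightarrow>
    feasible N M U a y z u \<and>
    (\<forall>i\<in>{1..M}. \<forall>s\<in>{0..<N}. (2 * w i) *\<^sub>R (G (z s i) *v u s i) + \<mu> s i = 0) \<and>
    (\<forall>i\<in>{1..M}. \<forall>s\<in>{1..<N}. g s i + \<mu> s i = \<mu> (s - 1) i) \<and>
    (\<Sum>i=1..M. \<mu> (N - 1) i) = 0"
proof (cases "feasible N M U a y z u")
  \<comment> \<open>Feasibility provides the common endpoint that the endpoint derivative requires;
    without feasibility both sides are false.\<close>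
  case True
  then have "\<And>i. i \<in> {1..M} \<Longrightarrow> z N i = y"
    by (simp add: feasible_def)
  note D = lagrangian_partial_derivatives[where z=z and u=u and w=w and \<rho>=\<rho> and g=g and \<mu>=\<mu>,
      OF assms(1) this diff]
  have zero_iff: "GDERIV f x :> 0 \<longleftrightarrow> d = 0" if "GDERIV f x :> d" for f x and d :: "real^'d"
    using that GDERIV_unique by metis
  have "(\<forall>i\<in>{1..M}. \<forall>s\<in>{0..<N}.
        GDERIV (\<lambda>v. lagrangian N M G S w \<rho> z (upd u s i v) \<mu>) (u s i) :> 0) \<longleftrightarrow>
      (\<forall>i\<in>{1..M}. \<forall>s\<in>{0..<N}. (2 * w i) *\<^sub>R (G (z s i) *v u s i) + \<mu> s i = 0)"
    by (intro ball_cong refl zero_iff D(1)) auto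
  moreover have "(\<forall>i\<in>{1..M}. \<forall>s\<in>{1..<N}.
        GDERIV (\<lambda>x. lagrangian N M G S w \<rho> (upd z s i x) u \<mu>) (z s i) :> 0) \<longleftrightarrow>
      (\<forall>i\<in>{1..M}. \<forall>s\<in>{1..<N}. g s i + \<mu> s i - \<mu> (s - 1) i = 0)"
    by (intro ball_cong refl zero_iff D(2)) auto
  moreover have "GDERIV (\<lambda>x. lagrangian N M G S w \<rho> (z(N := (\<lambda>i. x))) u \<mu>) y :> 0 \<longleftrightarrow>
      - (\<Sum>i=1..M. \<mu> (N - 1) i) = 0"
    by (rule zero_iff[OF D(3)])
  ultimately show ?thesis
    using True unfolding necessary_conditions_def by simp
qed (simp add: necessary_conditions_def)

text \<open>The multipliers are given explicitly by solving the control equation for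
  \<open>\<mu>\<close>; the other conditions come from two kinds of feasible variation.\<close>

lemma local_minimizer_necessary_conditions:
  fixes G :: "real^'d \<Rightarrow> real^'d^'d"
  assumes "N \<ge> 1" and min: "local_minimizer N M U a G S w \<rho> y z u" and "open U"
    and diff: "\<And>s i. s < N \<Longrightarrow> i \<in> {1..M} \<Longrightarrow> transpose (G (z s i)) = G (z s i)"
      "\<And>s i. s < N \<Longrightarrow> i \<in> {1..M} \<Longrightarrow> G differentiable (at (z s i))"
      "\<And>s i. s < N \<Longrightarrow> i \<in> {1..M} \<Longrightarrow> S differentiable (at (z s i))"
      "\<And>s i. s < N \<Longrightarrow> i \<in> {1..M} \<Longrightarrow>
        GDERIV (\<lambda>x. stage_cost G S (w i) (\<rho> i) x (u s i)) (z s i) :> g s i"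
  shows "\<exists>\<mu>. necessary_conditions N M U a G S w \<rho> y z u \<mu>"
proof -
  define \<mu> where "\<mu> s i = - (2 * w i) *\<^sub>R (G (z s i) *v u s i)" for s i
  have stat: "(\<Sum>i=1..M. \<Sum>s<N. \<alpha> s i *\<^sub>R g s i - (\<alpha> (Suc s) i - \<alpha> s i) *\<^sub>R \<mu> s i) = 0"
    if "\<And>i. i \<in> {1..M} \<Longrightarrow> \<alpha> 0 i = 0" "\<And>i. i \<in> {1..M} \<Longrightarrow> \<alpha> N i = c" for \<alpha> c
    using local_minimizer_stationary[OF min \<open>open U\<close> diff that] by (simp add: \<mu>_def)
  have "g s i + \<mu> s i = \<mu> (s - 1) i" if "s \<in> {1..<N}" "i \<in> {1..M}" for s i
  proof -
    \<comment> \<open>A single interior state moves; as \<open>s\<close> is neither 0 nor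
      \<open>N\<close>, the endpoint rate is 0.\<close>
    let ?\<alpha> = "\<lambda>t j. of_bool ((t, j) = (s, i)) :: real"
    have "0 = (\<Sum>j=1..M. \<Sum>t<N. ?\<alpha> t j *\<^sub>R g t j - (?\<alpha> (Suc t) j - ?\<alpha> t j) *\<^sub>R \<mu> t j)"
      using stat[of ?\<alpha> 0] that by simp
    also have "\<dots> = g s i + \<mu> s i - \<mu> (s - 1) i"
      using that by (subst double_sum_pair[of s N i M]) auto
    finally show ?thesis by simp
  qed
  moreover have "(\<Sum>i=1..M. \<mu> (N - 1) i) = 0"
  proof -
    \<comment> \<open>The common endpoint moves at rate 1; \<open>N \<ge> 1\<close> keeps the
      starting points fixed.\<close>
    let ?\<alpha> = "\<lambda>t j::nat. of_bool (t = N) :: real"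
    have "0 = (\<Sum>j=1..M. \<Sum>t<N. ?\<alpha> t j *\<^sub>R g t j - (?\<alpha> (Suc t) j - ?\<alpha> t j) *\<^sub>R \<mu> t j)"
      using stat[of ?\<alpha> 1] assms(1) by simp
    also have "\<dots> = - (\<Sum>i=1..M. \<mu> (N - 1) i)"
      using assms(1) by (subst double_sum_last) (auto simp: sum_negf)
    finally show ?thesis by simp
  qed
  moreover have "feasible N M U a y z u"
    using min by (simp add: local_minimizer_def)
  ultimately have "necessary_conditions N M U a G S w \<rho> y z u \<mu>"
    by (subst necessary_conditions_iff[OF assms(1) diff]) (auto simp: \<mu>_def)
  then show ?thesis by blast
qed

theorem propositionA8:
  fixes N M :: nat
    and a :: "nat \<Rightarrow> real^'d" and w \<rho> :: "nat \<Rightarrow> real" and lam :: real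
    and U :: "(real^'d) set"
    and G :: "real^'d \<Rightarrow> real^'d^'d" and S :: "real^'d \<Rightarrow> real"
    and zk uk :: "nat \<Rightarrow> nat \<Rightarrow> real^'d"
    and Gk :: "nat \<Rightarrow> nat \<Rightarrow> real^'d^'d" and \<nu> :: "nat \<Rightarrow> nat \<Rightarrow> real^'d"
  assumes "N \<ge> 1" and "M \<ge> 1"
    and "open U" and "\<And>i. i \<in> {1..M} \<Longrightarrow> a i \<in> U"
    and "\<And>i. i \<in> {1..M} \<Longrightarrow> w i > 0" and "lam > 0"
    and "\<And>x. x \<in> U \<Longrightarrow> transpose (G x) = G x"
    and "\<And>x v. x \<in> U \<Longrightarrow> v \<noteq> 0 \<Longrightarrow> v \<bullet> (G x *v v) > 0"
    and "G differentiable_on U"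
    and "S differentiable_on U" and "bdd_below (S ` U)"
    (* the factor of S: as in the stated objective, or as in the stated formula for nu *)
    and "\<rho> = (\<lambda>i. w i * lam) \<or> \<rho> = (\<lambda>i. lam)"
    and "\<And>s i. s \<in> {0..<N} \<Longrightarrow> i \<in> {1..M} \<Longrightarrow> zk s i \<in> U"
    and "\<And>s i. s \<in> {0..<N} \<Longrightarrow> i \<in> {1..M} \<Longrightarrow> Gk s i = G (zk s i)"
    and "\<And>s i. s \<in> {1..<N} \<Longrightarrow> i \<in> {1..M} \<Longrightarrow>
           GDERIV (\<lambda>x. w i * (uk s i \<bullet> (G x *v uk s i)) + \<rho> i * S x) (zk s i) :> \<nu> s i"
  shows
    "(\<forall>y z u. local_minimizer N M U a G S w \<rho> y z u \<longrightarrow>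
        (\<exists>\<mu>. necessary_conditions N M U a G S w \<rho> y z u \<mu>)) \<and>
     (\<forall>y z u \<mu>.
        (\<forall>i\<in>{1..M}. \<forall>s\<in>{0..N}. z s i \<in> U) \<and>
        (\<forall>i\<in>{1..M}. \<forall>s\<in>{0..<N}. G (z s i) = Gk s i) \<and>
        (\<forall>i\<in>{1..M}. \<forall>s\<in>{1..<N}.
           GDERIV (\<lambda>x. stage_cost G S (w i) (\<rho> i) x (u s i)) (z s i) :> \<nu> s i) \<longrightarrow>
        (necessary_conditions N M U a G S w \<rho> y z u \<mu> \<longleftrightarrow>
         frozen_system N M a w Gk \<nu> y z u \<mu>)) \<and>
     (\<forall>i\<in>{1..M}. (\<forall>s\<in>{0..<N}. invertible (Gk s i)) \<and> invertible (sum_inv N Gk i)) \<and>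
     invertible (W_mat N M w Gk) \<and>
     (\<exists>y z u \<mu>. frozen_system N M a w Gk \<nu> y z u \<mu>) \<and>
     (\<forall>y z u \<mu>. frozen_system N M a w Gk \<nu> y z u \<mu> \<longleftrightarrow>
        update_scheme N M a w Gk \<nu> y z u \<mu> \<and>
        (\<forall>i\<in>{1..M}. z N i = y) \<and>
        (\<forall>i\<in>{1..M}. \<forall>s\<in>{0..<N}. \<mu> s i = \<mu> (N - 1) i + nu_tail N \<nu> s i))"

proof -
  note N = assms(1) and M = assms(2) and w = assms(5)
  have diffG: "G differentiable (at x)" and diffS: "S differentiable (at x)" if "x \<in> U" for x
    using assms(3,9,10) that
    by (auto simp: differentiable_on_eq_differentiable_at)
  have Gk: "pos_def (Gk s i)" if "s < N" "i \<in> {1..M}" for s i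
    using assms(8,13,14) that by (simp add: pos_def_def)
  have sum_pd: "pos_def (sum_inv N Gk i)" if "i \<in> {1..M}" for i
    unfolding sum_inv_def using N Gk that by (intro pos_def_sum pos_def_matrix_inv)
      (auto simp: lessThan_empty_iff)
  have "pos_def (W_mat N M w Gk)"
    unfolding W_mat_def using M w sum_pd
    by (intro pos_def_sum pos_def_scaleR pos_def_matrix_inv) auto
  then have W: "invertible (W_mat N M w Gk)"
    by (rule pos_def_invertible)
  have inv: "invertible (Gk s i)" if "s < N" "i \<in> {1..M}" for s i
    using Gk that by (intro pos_def_invertible)
  have Q: "invertible (sum_inv N Gk i)" if "i \<in> {1..M}" for i
    using sum_pd that by (intro pos_def_invertible)
  \<comment> \<open>The stationarity lemmas take a gradient at every stage, including
    \<open>s = 0\<close>, where \<open>\<nu>\<close> is unspecified; differentiability supplies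
    one.\<close>
  have gradient: "\<exists>g. \<forall>s i. s < N \<and> i \<in> {1..M} \<longrightarrow>
      GDERIV (\<lambda>x. stage_cost G S (w i) (\<rho> i) x (u s i)) (z s i) :> g s i"
    if zU: "\<And>s i. s < N \<Longrightarrow> i \<in> {1..M} \<Longrightarrow> z s i \<in> U" for z u :: "nat \<Rightarrow> nat \<Rightarrow> real^'d"
  proof (intro exI allI impI, elim conjE)
    fix s i assume si: "s < N" "i \<in> {1..M}"
    obtain g where "GDERIV (\<lambda>x. stage_cost G S (w i) (\<rho> i) x (u s i)) (z s i) :> g"
      using stage_cost_has_gradient[OF diffG[OF zU[OF si]] diffS[OF zU[OF si]]] .
    then show "GDERIV (\<lambda>x. stage_cost G S (w i) (\<rho> i) x (u s i)) (z s i) :>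
        (SOME g. GDERIV (\<lambda>x. stage_cost G S (w i) (\<rho> i) x (u s i)) (z s i) :> g)"
      by (rule someI)
  qed
  have "\<exists>\<mu>. necessary_conditions N M U a G S w \<rho> y z u \<mu>"
    if "local_minimizer N M U a G S w \<rho> y z u" for y z u
  proof -
    have zU: "z s i \<in> U" if "s < N" "i \<in> {1..M}" for s i
      using \<open>local_minimizer N M U a G S w \<rho> y z u\<close> that
      by (simp add: local_minimizer_def feasible_def)
    obtain g where "\<forall>s i. s < N \<and> i \<in> {1..M} \<longrightarrow>
        GDERIV (\<lambda>x. stage_cost G S (w i) (\<rho> i) x (u s i)) (z s i) :> g s i"
      using gradient[of z u] zU by blast
    then show ?thesis
      using zU by (intro local_minimizer_necessary_conditions[OF N that assms(3)] assms(7)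
          diffG diffS) auto
  qed
  moreover have "necessary_conditions N M U a G S w \<rho> y z u \<mu> \<longleftrightarrow> frozen_system N M a w Gk \<nu> y z u \<mu>"
    if zU: "\<forall>i\<in>{1..M}. \<forall>s\<in>{0..N}. z s i \<in> U"
      and G_eq: "\<forall>i\<in>{1..M}. \<forall>s\<in>{0..<N}. G (z s i) = Gk s i"
      and \<nu>: "\<forall>i\<in>{1..M}. \<forall>s\<in>{1..<N}.
        GDERIV (\<lambda>x. stage_cost G S (w i) (\<rho> i) x (u s i)) (z s i) :> \<nu> s i"
    for y z u \<mu>
  proof -
    obtain g where g: "\<forall>s i. s < N \<and> i \<in> {1..M} \<longrightarrow>
        GDERIV (\<lambda>x. stage_cost G S (w i) (\<rho> i) x (u s i)) (z s i) :> g s i"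
      using gradient[of z u] zU by auto
    \<comment> \<open>Agreement from stage 1 on suffices, because the costate equations start
      there.\<close>
    have g_eq: "g s i = \<nu> s i" if "s \<in> {1..<N}" "i \<in> {1..M}" for s i
      using g \<nu> that by (intro GDERIV_unique) auto
    have feas: "feasible N M U a y z u \<longleftrightarrow>
        (\<forall>i\<in>{1..M}. \<forall>s\<in>{0..<N}. z (s + 1) i = z s i + u s i) \<and>
        (\<forall>i\<in>{1..M}. z 0 i = a i \<and> z N i = y)"
      using zU by (auto simp: feasible_def)
    have "necessary_conditions N M U a G S w \<rho> y z u \<mu> \<longleftrightarrow>
        feasible N M U a y z u \<and>
        (\<forall>i\<in>{1..M}. \<forall>s\<in>{0..<N}. (2 * w i) *\<^sub>R (G (z s i) *v u s i) + \<mu> s i = 0) \<and>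
        (\<forall>i\<in>{1..M}. \<forall>s\<in>{1..<N}. g s i + \<mu> s i = \<mu> (s - 1) i) \<and>
        (\<Sum>i=1..M. \<mu> (N - 1) i) = 0"
      using zU g by (intro necessary_conditions_iff[OF N] assms(7) diffG diffS) auto
    also have "\<dots> \<longleftrightarrow> frozen_system N M a w Gk \<nu> y z u \<mu>"
      using G_eq g_eq unfolding frozen_system_def feas by auto
    finally show ?thesis .
  qed
  moreover have "\<exists>y z u \<mu>. frozen_system N M a w Gk \<nu> y z u \<mu>"
    by (rule frozen_system_solvable[OF N w inv Q W])
  moreover have "frozen_system N M a w Gk \<nu> y z u \<mu> \<longleftrightarrow>
        update_scheme N M a w Gk \<nu> y z u \<mu> \<and>
        (\<forall>i\<in>{1..M}. z N i = y) \<and>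
        (\<forall>i\<in>{1..M}. \<forall>s\<in>{0..<N}. \<mu> s i = \<mu> (N - 1) i + nu_tail N \<nu> s i)" for y z u \<mu>
    by (rule frozen_system_iff_update_scheme[OF N w inv Q W])
  moreover have "\<forall>i\<in>{1..M}. (\<forall>s\<in>{0..<N}. invertible (Gk s i)) \<and> invertible (sum_inv N Gk i)"
    using inv Q by simp
  ultimately show ?thesis
    using W by blast
qed

end
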